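(* A group of order $5$ has a $16$-dimensional real representation whose elements define five mutually unbiased bases in $\mathbb{R}^{16}$, and a group of order $3$ has a $4$-dimensional real representation whose elements define three mutually unbiased bases in $\mathbb{R}^{4}$. Moreover, every finite group of odd order has a faithful representation by real scaled Hadamard matrices of $2$-power size.
   Context: Two orthonormal bases $\{u_1,\dots,u_d\}$ and $\{v_1,\dots,v_d\}$ of $\mathbb{R}^d$ are mutually unbiased if $\langle u_i,v_j\rangle^2=1/d$ for all $i,j$. A $d\times d$ real orthogonal matrix is identified with an orthonormal basis of $\mathbb{R}^d$. The bases corresponding to orthogonal matrices $O_1,O_2$ are mutually unbiased if and only if every entry of $O_1O_2^{-1}$ equals $\pm1/\sqrt d$. The elements of a representation $R$ of $G$ define $|G|$ mutually unbiased bases if every $R(\sigma)$ is a real orthogonal matrix and, for distinct $\sigma,\tau\in G$, the bases corresponding to $R(\sigma)$ and $R(\tau)$ are mutually unbiased. A representation $R$ of $G$ by real scaled Hadamard matrices of size $d$ is a homomorphism $R$ from $G$ to the group of real orthogonal $d\times d$ matrices such that, for every non-identity $\sigma\in G$, all entries of $R(\sigma)$ are $\pm1/\sqrt d$ (equivalently, $\sqrt d\,R(\sigma)$ is a real Hadamard matrix). It is of $2$-power size if $d$ is a power of $2$. *)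

theory Defs
  imports Complex_Main "HOL-Algebra.Algebra" "Jordan_Normal_Form.VS_Connect"
begin

definition general_linear_group :: "nat \<Rightarrow> real mat monoid" where
  "general_linear_group d = units_of (ring_mat TYPE(real) d ())"

definition orthogonal_matrix :: "nat \<Rightarrow> real mat \<Rightarrow> bool" where
  "orthogonal_matrix d A \<longleftrightarrow>
     A \<in> carrier_mat d d \<and> A * A\<^sup>T = 1\<^sub>m d \<and> A\<^sup>T * A = 1\<^sub>m d"

definition orthogonal_group :: "nat \<Rightarrow> real mat monoid" where
  "orthogonal_group d = (general_linear_group d)\<lparr>carrier := {A. orthogonal_matrix d A}\<rparr>"

definition real_representation ::
    "('a, 'b) monoid_scheme \<Rightarrow> nat \<Rightarrow> ('a \<Rightarrow> real mat) \<Rightarrow> bool" where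
  "real_representation G d R \<longleftrightarrow> R \<in> hom G (general_linear_group d)"

text \<open>Families of \<open>d\<close> vectors are indexed by \<open>0, \<dots>, d - 1\<close>.\<close>

definition orthonormal_basis :: "nat \<Rightarrow> (nat \<Rightarrow> real vec) \<Rightarrow> bool" where
  "orthonormal_basis d u \<longleftrightarrow>
     vectorspace.basis class_ring (module_vec TYPE(real) d) (u ` {..<d}) \<and>
     (\<forall>i<d. \<forall>j<d. u i \<bullet> u j = (if i = j then 1 else 0))"

definition mutually_unbiased ::
    "nat \<Rightarrow> (nat \<Rightarrow> real vec) \<Rightarrow> (nat \<Rightarrow> real vec) \<Rightarrow> bool" where
  "mutually_unbiased d u v \<longleftrightarrow>
     orthonormal_basis d u \<and> orthonormal_basis d v \<and>
     (\<forall>i<d. \<forall>j<d. (u i \<bullet> v j)\<^sup>2 = 1 / real d)"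

text \<open>The basis corresponding to an orthogonal matrix \<open>A\<close> is the family \<open>row A\<close> of its rows:
  the inner products of the rows of \<open>A\<close> with those of \<open>B\<close> are the entries of
  \<open>A * B\<^sup>T\<close>, which for orthogonal \<open>B\<close> is \<open>A\<close> times the inverse of \<open>B\<close>.\<close>

definition defines_MUBs ::
    "('a, 'b) monoid_scheme \<Rightarrow> nat \<Rightarrow> ('a \<Rightarrow> real mat) \<Rightarrow> bool" where
  "defines_MUBs G d R \<longleftrightarrow>
     (\<forall>\<sigma>\<in>carrier G. orthogonal_matrix d (R \<sigma>)) \<and>
     (\<forall>\<sigma>\<in>carrier G. \<forall>\<tau>\<in>carrier G. \<sigma> \<noteq> \<tau> \<longrightarrow>
        mutually_unbiased d (row (R \<sigma>)) (row (R \<tau>)))"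

definition scaled_Hadamard_representation ::
    "('a, 'b) monoid_scheme \<Rightarrow> nat \<Rightarrow> ('a \<Rightarrow> real mat) \<Rightarrow> bool" where
  "scaled_Hadamard_representation G d R \<longleftrightarrow>
     R \<in> hom G (orthogonal_group d) \<and>
     (\<forall>\<sigma>\<in>carrier G. \<sigma> \<noteq> \<one>\<^bsub>G\<^esub> \<longrightarrow>
        (\<forall>i<d. \<forall>j<d. R \<sigma> $$ (i, j) \<in> {1 / sqrt (real d), - 1 / sqrt (real d)}))"

end

(* Permutation matrices form a representation, and conjugating them by one orthogonal matrix M keeps
   it one. For a finite group G take M to be the tensor product, over x in G, of bases E x of R^Y that
   are pairwise mutually unbiased, and let G permute the tensor factors by left translation. For
   g different from 1 the entries of the conjugated permutation matrix are products over x of inner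
   products between vectors of E (g x) and of E x, hence all equal to +-1/sqrt d.

   Arbitrarily many mutually unbiased bases in 2-power dimension come from the space V of even subsets
   of Z/p, p an odd prime, under symmetric difference. Cyclic shifts act on V, and the difference of two
   distinct ones is invertible, because a set invariant under a nonzero shift is empty or all of Z/p,
   which has odd size. So the bilinear forms (a, b) |-> |(a shifted by t) Int b| mod 2, for t < p, have
   nondegenerate differences, and the bases of R^(V x V) given by the corresponding signs times the
   characters of V x V are mutually unbiased.

   In dimensions 4 and 16 a single orthogonal matrix A of order 3 or 5 suffices; its powers A^k with
   2 k > p are transposes of lower powers. *)

theory Submission
  imports Defs "HOL-Number_Theory.Cong"
begin

section \<open>Orthogonal matrices and scaled Hadamard representations\<close>

lemma orthogonal_matrixI:
  assumes "A \<in> carrier_mat d d" "A * A\<^sup>T = 1\<^sub>m d"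
  shows "orthogonal_matrix d A"
  using assms mat_mult_left_right_inverse[of A d "A\<^sup>T"] by (simp add: orthogonal_matrix_def)

lemma orthogonal_matrix_GL:
  assumes "orthogonal_matrix d A"
  shows "A \<in> carrier (general_linear_group d)"
proof -
  have "A\<^sup>T \<in> carrier_mat d d" using assms by (simp add: orthogonal_matrix_def)
  then show ?thesis
    using assms
    by (auto simp: general_linear_group_def units_of_def Units_def orthogonal_matrix_def
        ring_mat_simps intro!: bexI[of _ "A\<^sup>T"])
qed

lemma orthogonal_group_simps [simp]:
  "carrier (orthogonal_group d) = {A. orthogonal_matrix d A}"
  "A \<otimes>\<^bsub>orthogonal_group d\<^esub> B = A * B"
  by (simp_all add: orthogonal_group_def general_linear_group_def units_of_def ring_mat_simps)

lemma orthogonal_matrix_row_scalar_prod: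
  assumes "orthogonal_matrix d A" "orthogonal_matrix d B" "i < d" "j < d"
  shows "row A i \<bullet> row B j = (A * B\<^sup>T) $$ (i, j)"
  using assms by (auto simp: orthogonal_matrix_def)

lemma orthogonal_matrix_orthonormal_basis:
  assumes A: "orthogonal_matrix d A"
  shows "orthonormal_basis d (row A)"
proof -
  have AC: "A \<in> carrier_mat d d" and AA: "A * A\<^sup>T = 1\<^sub>m d"
    using A by (auto simp: orthogonal_matrix_def)
  have prod: "row A i \<bullet> row A j = (if i = j then 1 else 0)" if "i < d" "j < d" for i j
    using orthogonal_matrix_row_scalar_prod[OF A A that] that by (simp add: AA)
  interpret vec_space "TYPE(real)" d .
  have "det A * det A = 1"
    using arg_cong[OF AA, of det] AC by (simp add: det_mult[OF AC] det_transpose[OF AC])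
  then have "det A \<noteq> 0" by auto
  then have li: "lin_indpt (set (rows A))" by (rule det_not_0_imp_lin_indpt_rows[OF AC])
  have rows: "set (rows A) = row A ` {..<d}"
    using AC by (auto simp: rows_def)
  \<comment> \<open>\<open>basis\<close> speaks of the set of rows, so the dimension count needs the
    rows to be pairwise distinct.\<close>
  have inj: "inj_on (row A) {..<d}"
  proof (rule inj_onI)
    fix i j assume "i \<in> {..<d}" "j \<in> {..<d}" "row A i = row A j"
    then have "row A i \<bullet> row A j = 1" using prod[of i i] by simp
    then show "i = j"
      using prod[of i j] \<open>i \<in> {..<d}\<close> \<open>j \<in> {..<d}\<close> by (simp split: if_splits)
  qed
  have "basis (row A ` {..<d})"
    using AC li card_image[OF inj]
    by (intro dim_li_is_basis) (auto simp: rows dim_is_n)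
  then show ?thesis using prod by (simp add: orthonormal_basis_def)
qed

lemma scaled_Hadamard_representation_real_representation:
  assumes "scaled_Hadamard_representation G d R"
  shows "real_representation G d R"
proof -
  have "R x \<in> carrier (general_linear_group d)" if "x \<in> carrier G" for x
    using assms that by (intro orthogonal_matrix_GL) (auto simp: scaled_Hadamard_representation_def hom_def)
  moreover have "R (x \<otimes>\<^bsub>G\<^esub> y) = R x \<otimes>\<^bsub>general_linear_group d\<^esub> R y"
    if "x \<in> carrier G" "y \<in> carrier G" for x y
    using assms that
    by (simp add: scaled_Hadamard_representation_def hom_def orthogonal_group_def)
  ultimately show ?thesis
    unfolding real_representation_def by (intro homI)
qed

text \<open>For distinct s and t, \<open>R s\<close> times the transpose of \<open>R t\<close> is
  the value of \<open>R\<close> at s t^(-1), a non-identity element. So the inner products between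
  the two bases are the entries of one scaled Hadamard matrix.\<close>

lemma scaled_Hadamard_representation_defines_MUBs:
  assumes G: "group G" and R: "scaled_Hadamard_representation G d R"
  shows "defines_MUBs G d R"
  unfolding defines_MUBs_def
proof (intro conjI ballI impI)
  interpret group G by fact
  have hom: "R (x \<otimes>\<^bsub>G\<^esub> y) = R x * R y" if "x \<in> carrier G" "y \<in> carrier G" for x y
    using R that by (auto simp: scaled_Hadamard_representation_def hom_def)
  show orth: "orthogonal_matrix d (R s)" if "s \<in> carrier G" for s
    using R that by (auto simp: scaled_Hadamard_representation_def hom_def)
  fix s t assume s: "s \<in> carrier G" and t: "t \<in> carrier G" and "s \<noteq> t"
  define x where "x = s \<otimes>\<^bsub>G\<^esub> inv\<^bsub>G\<^esub> t"
  have sx: "s = x \<otimes>\<^bsub>G\<^esub> t" using s t by (simp add: x_def m_assoc)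
  have x: "x \<in> carrier G" using s t by (simp add: x_def)
  have x1: "x \<noteq> \<one>\<^bsub>G\<^esub>" using sx t \<open>s \<noteq> t\<close> by auto
  from sx have "R s * (R t)\<^sup>T = R x * R t * (R t)\<^sup>T" using hom x t by simp
  also have "\<dots> = R x * (R t * (R t)\<^sup>T)"
    using orth[OF x] orth[OF t]
    by (intro assoc_mult_mat[of _ d d _ d _ d]) (auto simp: orthogonal_matrix_def)
  finally have *: "R s * (R t)\<^sup>T = R x"
    using orth[OF t] orth[OF x] by (auto simp: orthogonal_matrix_def)
  have "(row (R s) i \<bullet> row (R t) j)\<^sup>2 = 1 / real d" if "i < d" "j < d" for i j
  proof -
    have "R x $$ (i, j) \<in> {1 / sqrt (real d), - 1 / sqrt (real d)}"
      using R x x1 that by (auto simp: scaled_Hadamard_representation_def)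
    then show ?thesis
      unfolding orthogonal_matrix_row_scalar_prod[OF orth[OF s] orth[OF t] that] *
      by (auto simp: power_divide)
  qed
  then show "mutually_unbiased d (row (R s)) (row (R t))"
    using orthogonal_matrix_orthonormal_basis orth s t by (auto simp: mutually_unbiased_def)
qed

text \<open>Distinct elements with equal images would give a basis unbiased to itself, but its first
  two vectors have inner product 0. In dimension 1 the trivial representation satisfies the
  definition, hence the bound on \<open>d\<close>.\<close>

lemma scaled_Hadamard_representation_inj_on:
  assumes G: "group G" and R: "scaled_Hadamard_representation G d R" and d: "d \<ge> 2"
  shows "inj_on R (carrier G)"
proof (rule inj_onI)
  fix s t assume s: "s \<in> carrier G" and t: "t \<in> carrier G" and eq: "R s = R t"
  have M: "defines_MUBs G d R" by (rule scaled_Hadamard_representation_defines_MUBs[OF G R])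
  show "s = t"
  proof (rule ccontr)
    assume "s \<noteq> t"
    then have "mutually_unbiased d (row (R s)) (row (R s))"
      using M s t eq unfolding defines_MUBs_def by metis
    then have *: "(row (R s) i \<bullet> row (R s) j)\<^sup>2 = 1 / real d"
      "row (R s) i \<bullet> row (R s) j = (if i = j then 1 else 0)" if "i < d" "j < d" for i j
      using that unfolding mutually_unbiased_def orthonormal_basis_def by blast+
    show False using *[of 0 1] d by simp
  qed
qed

section \<open>Powers of one orthogonal matrix and groups of prime order\<close>

lemma pow_mat_add:
  fixes A :: "real mat"
  assumes "A \<in> carrier_mat d d"
  shows "A ^\<^sub>m (i + j) = A ^\<^sub>m i * A ^\<^sub>m j"
proof (induction j)
  case 0
  then show ?case using assms pow_mat_dim_square[OF assms] by (auto simp: pow_mat_dim)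
next
  case (Suc j)
  have "A ^\<^sub>m i \<in> carrier_mat d d" "A ^\<^sub>m j \<in> carrier_mat d d" using assms by auto
  then show ?case using Suc assms by (simp add: assoc_mult_mat[of _ d d _ d _ d])
qed

lemma pow_mat_mod:
  fixes A :: "real mat"
  assumes A: "A \<in> carrier_mat d d" and p: "A ^\<^sub>m p = 1\<^sub>m d"
  shows "A ^\<^sub>m i = A ^\<^sub>m (i mod p)"
proof -
  have "A ^\<^sub>m (p * k + j) = A ^\<^sub>m j" for k j
  proof (induction k)
    case (Suc k)
    have "A ^\<^sub>m (p * Suc k + j) = A ^\<^sub>m p * A ^\<^sub>m (p * k + j)"
      by (subst pow_mat_add[OF A, symmetric]) (simp add: algebra_simps)
    then show ?case using p Suc left_mult_one_mat[OF pow_carrier_mat[OF A]] by simp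
  qed simp
  from this[of "i div p" "i mod p"] show ?thesis by simp
qed

lemma orthogonal_matrix_mult:
  assumes A: "orthogonal_matrix d A" and B: "orthogonal_matrix d B"
  shows "orthogonal_matrix d (A * B)"
proof (rule orthogonal_matrixI)
  have AB: "A \<in> carrier_mat d d" "B \<in> carrier_mat d d" using A B by (auto simp: orthogonal_matrix_def)
  have T: "A\<^sup>T \<in> carrier_mat d d" "B\<^sup>T \<in> carrier_mat d d" using AB by auto
  show "A * B \<in> carrier_mat d d" using AB by simp
  have "A * B * (A * B)\<^sup>T = A * B * (B\<^sup>T * A\<^sup>T)" using transpose_mult AB by metis
  also have "\<dots> = A * (B * (B\<^sup>T * A\<^sup>T))" using AB T by (simp add: assoc_mult_mat[of _ d d _ d _ d])
  also have "B * (B\<^sup>T * A\<^sup>T) = (B * B\<^sup>T) * A\<^sup>T" using AB T by (simp add: assoc_mult_mat[of _ d d _ d _ d])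
  finally show "A * B * (A * B)\<^sup>T = 1\<^sub>m d" using A B T left_mult_one_mat[OF T(1)] by (simp add: orthogonal_matrix_def)
qed

lemma orthogonal_matrix_pow:
  assumes "orthogonal_matrix d A"
  shows "orthogonal_matrix d (A ^\<^sub>m i)"
proof (induction i)
  case 0
  then show ?case using assms by (auto simp: orthogonal_matrix_def)
next
  case (Suc i)
  then show ?case using assms by (simp add: orthogonal_matrix_mult)
qed

text \<open>A non-identity element has order dividing \<open>p\<close> and different from 1, hence
  \<open>p\<close>, so its powers exhaust the group.\<close>

lemma prime_order_generator:
  assumes G: "group G" and p: "Coset.order G = p" "Factorial_Ring.prime p"
  obtains a where "a \<in> carrier G" "group.ord G a = p"
    "\<And>x. x \<in> carrier G \<Longrightarrow> \<exists>i. x = a [^]\<^bsub>G\<^esub> (i::nat)"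
proof -
  interpret group G by fact
  have "card (carrier G) = p" using p by (simp add: Coset.order_def)
  then have c: "card (carrier G) > 1" using p(2) prime_gt_1_nat by simp
  then have fin: "finite (carrier G)" using card.infinite by fastforce
  obtain a where a: "a \<in> carrier G" "a \<noteq> \<one>\<^bsub>G\<^esub>"
    using c by (metis One_nat_def card_le_Suc0_iff_eq fin not_le one_closed)
  have "ord a dvd p" using ord_dvd_group_order[OF a(1)] p by simp
  moreover have "ord a \<noteq> 1" using a ord_eq_1 by simp
  ultimately have o: "ord a = p" using p(2) by (auto simp: prime_nat_iff)
  have "card (generate G {a}) = card (carrier G)"
    using generate_pow_card[OF a(1)] o p by (simp add: Coset.order_def)
  moreover have "generate G {a} \<subseteq> carrier G" using a generate_incl by blast
  ultimately have "generate G {a} = carrier G" using fin card_subset_eq by blast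
  moreover have "generate G {a} = {a [^]\<^bsub>G\<^esub> k |k. k \<in> (UNIV :: nat set)}"
  proof (rule generate_pow_nat[OF a(1)])
    show "ord a \<noteq> 0" unfolding o using p(2) prime_gt_0_nat by auto
  qed
  ultimately have "carrier G = {a [^]\<^bsub>G\<^esub> k |k. k \<in> (UNIV :: nat set)}" by simp
  then have "\<exists>i. x = a [^]\<^bsub>G\<^esub> (i::nat)" if "x \<in> carrier G" for x using that by auto
  then show thesis using that[OF a(1) o] by simp
qed

text \<open>A generator is sent to \<open>A\<close>: its exponents are determined modulo
  \<open>p\<close>, and the powers of \<open>A\<close> depend on the exponent only modulo
  \<open>p\<close>.\<close>

lemma prime_order_scaled_Hadamard_representation:
  assumes G: "group G" and p: "Coset.order G = p" "Factorial_Ring.prime p"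
    and A: "orthogonal_matrix d A" and Ap: "A ^\<^sub>m p = 1\<^sub>m d"
    and entries: "\<And>k i j. 0 < k \<Longrightarrow> k < p \<Longrightarrow> i < d \<Longrightarrow> j < d \<Longrightarrow>
      (A ^\<^sub>m k) $$ (i, j) \<in> {1 / sqrt (real d), - 1 / sqrt (real d)}"
  shows "\<exists>R. scaled_Hadamard_representation G d R"
proof -
  interpret group G by fact
  obtain a where a: "a \<in> carrier G" and o: "ord a = p"
    and gen: "\<And>x. x \<in> carrier G \<Longrightarrow> \<exists>i. x = a [^]\<^bsub>G\<^esub> (i::nat)"
    using prime_order_generator[OF G p] by blast
  have AC: "A \<in> carrier_mat d d" using A by (simp add: orthogonal_matrix_def)
  \<comment> \<open>The exponent is an arbitrary choice; the next fact shows that the matrix does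
    not depend on it.\<close>
  define R where "R x = A ^\<^sub>m (SOME i. x = a [^]\<^bsub>G\<^esub> (i::nat))" for x
  have R: "R (a [^]\<^bsub>G\<^esub> i) = A ^\<^sub>m i" for i :: nat
  proof -
    define j where "j = (SOME j. a [^]\<^bsub>G\<^esub> i = a [^]\<^bsub>G\<^esub> (j::nat))"
    have "a [^]\<^bsub>G\<^esub> i = a [^]\<^bsub>G\<^esub> j" unfolding j_def by (rule someI) (rule refl)
    then have "int p dvd int j - int i"
      using int_pow_eq[OF a, of "int i" "int j"] o by (simp add: int_pow_int)
    then have "int i mod int p = int j mod int p" by (simp add: mod_eq_dvd_iff dvd_diff_commute)
    then have "i mod p = j mod p" by (simp flip: zmod_int)
    then have "A ^\<^sub>m i = A ^\<^sub>m j" using pow_mat_mod[OF AC Ap] by metis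
    then show ?thesis by (simp add: R_def j_def)
  qed
  have "R \<in> hom G (orthogonal_group d)"
  proof (rule homI)
    fix x assume "x \<in> carrier G"
    then show "R x \<in> carrier (orthogonal_group d)"
      by (simp add: R_def orthogonal_matrix_pow[OF A])
  next
    fix x y assume "x \<in> carrier G" "y \<in> carrier G"
    then obtain i j :: nat where xy: "x = a [^]\<^bsub>G\<^esub> i" "y = a [^]\<^bsub>G\<^esub> j" using gen by blast
    then have "R (x \<otimes>\<^bsub>G\<^esub> y) = A ^\<^sub>m (i + j)" using R nat_pow_mult[OF a] by simp
    then show "R (x \<otimes>\<^bsub>G\<^esub> y) = R x \<otimes>\<^bsub>orthogonal_group d\<^esub> R y"
      using pow_mat_add[OF AC] by (simp add: xy R)
  qed
  moreover have "R x $$ (i, j) \<in> {1 / sqrt (real d), - 1 / sqrt (real d)}"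
    if x: "x \<in> carrier G" "x \<noteq> \<one>\<^bsub>G\<^esub>" and ij: "i < d" "j < d" for x i j
  proof -
    obtain k :: nat where k: "x = a [^]\<^bsub>G\<^esub> k" using gen x by blast
    then have "\<not> p dvd k" using pow_eq_id[OF a] o x by simp
    then have "0 < k mod p" "k mod p < p" using p(2) by (auto simp: mod_greater_zero_iff_not_dvd prime_gt_0_nat)
    then show ?thesis using entries ij pow_mat_mod[OF AC Ap, of k] by (simp only: k R)
  qed
  ultimately show ?thesis unfolding scaled_Hadamard_representation_def by blast
qed

lemma smult_smult_mat: "a \<cdot>\<^sub>m (b \<cdot>\<^sub>m A) = (a * b :: 'a :: semigroup_mult) \<cdot>\<^sub>m A"
  by (intro eq_matI) (simp_all add: mult.assoc)

lemma transpose_smult: "(c \<cdot>\<^sub>m A)\<^sup>T = c \<cdot>\<^sub>m A\<^sup>T"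
  by (intro eq_matI) simp_all

text \<open>The two powers are inverse to each other, and the inverse of an orthogonal matrix is its
  transpose.\<close>

lemma orthogonal_matrix_pow_diff:
  assumes A: "orthogonal_matrix d A" and p: "A ^\<^sub>m p = 1\<^sub>m d" and k: "k \<le> p"
  shows "A ^\<^sub>m (p - k) = (A ^\<^sub>m k)\<^sup>T"
proof -
  let ?B = "A ^\<^sub>m (p - k)" and ?C = "A ^\<^sub>m k"
  have AC: "A \<in> carrier_mat d d" using A by (simp add: orthogonal_matrix_def)
  have B: "?B \<in> carrier_mat d d" and C: "?C \<in> carrier_mat d d" "?C\<^sup>T \<in> carrier_mat d d"
    using AC by auto
  have "?B * ?C = 1\<^sub>m d" using pow_mat_add[OF AC, of "p - k" k] k p by simp
  have "?B = ?B * (?C * ?C\<^sup>T)"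
    using orthogonal_matrix_pow[OF A, of k] right_mult_one_mat[OF B] by (simp add: orthogonal_matrix_def)
  also have "\<dots> = (?B * ?C) * ?C\<^sup>T" using B C by (simp add: assoc_mult_mat[of _ d d _ d _ d])
  also have "\<dots> = ?C\<^sup>T" using \<open>?B * ?C = 1\<^sub>m d\<close> left_mult_one_mat[OF C(2)] by simp
  finally show ?thesis .
qed

text \<open>The entry condition is invariant under transposition, so the exponents k and p - k need
  one check between them. This leaves k = 1 for p = 3, and k = 1, 2 for p = 5.\<close>

lemma prime_order_scaled_Hadamard_representation_half:
  assumes G: "group G" and p: "Coset.order G = p" "Factorial_Ring.prime p"
    and A: "orthogonal_matrix d A" and Ap: "A ^\<^sub>m p = 1\<^sub>m d"
    and entries: "\<And>k i j. 0 < k \<Longrightarrow> 2 * k \<le> p \<Longrightarrow> i < d \<Longrightarrow> j < d \<Longrightarrow>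
      (A ^\<^sub>m k) $$ (i, j) \<in> {1 / sqrt (real d), - 1 / sqrt (real d)}"
  shows "\<exists>R. scaled_Hadamard_representation G d R"
proof (rule prime_order_scaled_Hadamard_representation[OF G p A Ap])
  fix k i j assume k: "0 < k" "k < p" and ij: "i < d" "j < d"
  show "(A ^\<^sub>m k) $$ (i, j) \<in> {1 / sqrt (real d), - 1 / sqrt (real d)}"
  proof (cases "2 * k \<le> p")
    case False
    then have "0 < p - k" "2 * (p - k) \<le> p" using k by auto
    moreover have "(A ^\<^sub>m k) $$ (i, j) = (A ^\<^sub>m (p - k)) $$ (j, i)"
    proof -
      have "A ^\<^sub>m (p - k) \<in> carrier_mat d d" using A by (simp add: orthogonal_matrix_def)
      from carrier_matD[OF this] show ?thesis
        using orthogonal_matrix_pow_diff[OF A Ap, of "p - k"] k ij by simp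
    qed
    ultimately show ?thesis using entries[of "p - k" j i] ij by simp
  qed (use entries k ij in blast)
qed

section \<open>Groups of order 3 and 5\<close>

definition list_dot :: "int list \<Rightarrow> int list \<Rightarrow> int" where
  "list_dot xs ys = sum_list (map2 (*) xs ys)"

definition list_columns :: "nat \<Rightarrow> int list list \<Rightarrow> int list list" where
  "list_columns d A = map (\<lambda>j. map (\<lambda>r. r ! j) A) [0..<d]"

text \<open>Entries stay integers and the real scaling factor is kept outside, so that products can
  be evaluated by \<open>code_simp\<close>.\<close>

definition list_mult :: "nat \<Rightarrow> int list list \<Rightarrow> int list list \<Rightarrow> int list list" where
  "list_mult d A B = (let C = list_columns d B in map (\<lambda>r. map (list_dot r) C) A)"

definition list_square :: "nat \<Rightarrow> int list list \<Rightarrow> bool" where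
  "list_square d A \<longleftrightarrow> length A = d \<and> list_all (\<lambda>r. length r = d) A"

definition list_scalar :: "nat \<Rightarrow> int \<Rightarrow> int list list" where
  "list_scalar d c = map (\<lambda>i. map (\<lambda>j. if i = j then c else 0) [0..<d]) [0..<d]"

definition list_mat :: "nat \<Rightarrow> int list list \<Rightarrow> real mat" where
  "list_mat d A = mat d d (\<lambda>(i, j). real_of_int (A ! i ! j))"

lemma list_square_length:
  "list_square d A \<Longrightarrow> length A = d" "list_square d A \<Longrightarrow> i < d \<Longrightarrow> length (A ! i) = d"
  by (auto simp: list_square_def list_all_length)

lemma list_mat_carrier [simp]: "list_mat d A \<in> carrier_mat d d"
  by (simp add: list_mat_def)

lemma list_square_mult: "list_square d A \<Longrightarrow> list_square d (list_mult d A B)"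
  by (simp add: list_square_def list_mult_def list_columns_def list_all_length Let_def)

lemma list_mat_mult:
  assumes A: "list_square d A" and B: "list_square d B"
  shows "list_mat d A * list_mat d B = list_mat d (list_mult d A B)"
proof (rule eq_matI)
  fix i j assume "i < dim_row (list_mat d (list_mult d A B))" "j < dim_col (list_mat d (list_mult d A B))"
  then have ij: "i < d" "j < d" by (simp_all add: list_mat_def)
  have "list_mult d A B ! i ! j = list_dot (A ! i) (map (\<lambda>r. r ! j) B)"
    using ij list_square_length[OF A] by (simp add: list_mult_def list_columns_def Let_def)
  also have "\<dots> = (\<Sum>k<d. A ! i ! k * B ! k ! j)"
    using ij list_square_length[OF A] list_square_length[OF B]
    by (simp add: list_dot_def sum_list_sum_nth lessThan_atLeast0)
  finally show "(list_mat d A * list_mat d B) $$ (i, j) = list_mat d (list_mult d A B) $$ (i, j)"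
    using ij by (simp add: list_mat_def scalar_prod_def lessThan_atLeast0)
qed (simp_all add: list_mat_def)

lemma list_mat_transpose:
  assumes "list_square d A"
  shows "(list_mat d A)\<^sup>T = list_mat d (list_columns d A)"
  using list_square_length[OF assms] by (intro eq_matI) (simp_all add: list_mat_def list_columns_def)

lemma list_mat_scalar: "list_mat d (list_scalar d c) = real_of_int c \<cdot>\<^sub>m 1\<^sub>m d"
  by (intro eq_matI) (simp_all add: list_mat_def list_scalar_def)

lemma list_mat_map:
  assumes "list_square d A"
  shows "list_mat d (map (map ((*) c)) A) = real_of_int c \<cdot>\<^sub>m list_mat d A"
  using list_square_length[OF assms] by (intro eq_matI) (simp_all add: list_mat_def)

lemma list_mat_entry:
  assumes "list_square d A" "list_all (list_all (\<lambda>x. x = c \<or> x = - c)) A" "i < d" "j < d"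
  shows "list_mat d A $$ (i, j) \<in> {real_of_int c, - real_of_int c}"
proof -
  have "A ! i ! j = c \<or> A ! i ! j = - c"
    using assms(2-4) list_square_length[OF assms(1)] by (simp add: list_all_length)
  then show ?thesis using assms(3,4) by (auto simp: list_mat_def)
qed

lemma list_square_columns: "list_square d A \<Longrightarrow> list_square d (list_columns d A)"
  by (simp add: list_square_def list_columns_def list_all_length)

text \<open>Scaling turns an integer identity, matrix times transpose equals n times the identity,
  into orthogonality. The uses are c = 1/2 with n = 4 and c = 1/4 with n = 16.\<close>

lemma scaled_list_mat_orthogonal:
  assumes A: "list_square d A" and AA: "list_mult d A (list_columns d A) = list_scalar d n"
    and c: "c * c * real_of_int n = 1"
  shows "orthogonal_matrix d (c \<cdot>\<^sub>m list_mat d A)"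
proof (rule orthogonal_matrixI)
  have T: "(c \<cdot>\<^sub>m list_mat d A)\<^sup>T = c \<cdot>\<^sub>m list_mat d (list_columns d A)"
    by (simp add: transpose_smult list_mat_transpose[OF A])
  have "c \<cdot>\<^sub>m list_mat d A * (c \<cdot>\<^sub>m list_mat d (list_columns d A)) =
      (c * c) \<cdot>\<^sub>m (list_mat d A * list_mat d (list_columns d A))"
    by (simp add: mult_smult_assoc_mat[of _ d d _ d] mult_smult_distrib[of _ d d _ d] smult_smult_mat)
  also have "\<dots> = 1\<^sub>m d"
    by (rule eq_matI) (simp_all add: list_mat_mult A list_square_columns AA list_mat_scalar c[unfolded mult.assoc])
  finally show "c \<cdot>\<^sub>m list_mat d A * (c \<cdot>\<^sub>m list_mat d A)\<^sup>T = 1\<^sub>m d" by (simp add: T)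
qed simp

text \<open>Twice the matrix of left multiplication by the quaternion \<open>(- 1 + i + j + k) / 2\<close>, which has
  order \<open>3\<close>.\<close>

definition quaternion_signs :: "int list list" where
  "quaternion_signs =
    [[-1, -1, -1, -1],
     [1, -1, -1, 1],
     [1, 1, -1, -1],
     [1, -1, 1, -1]]"

text \<open>Let \<open>\<zeta>\<close> have order \<open>5\<close> in \<open>GF(16)\<close>, and let \<open>Q x = Tr (x\<^sup>3)\<close>. For \<open>0 < k < 5\<close> the difference of
  \<open>Q\<close> and \<open>x \<mapsto> Q (\<zeta>\<^sup>k x)\<close> is a nondegenerate quadratic form over \<open>GF(2)\<close>. Conjugating the permutation
  \<open>x \<mapsto> \<zeta> x\<close> by the signs \<open>(-1)\<^bsup>Q x\<^esup>\<close> and then by the character table of \<open>GF(2)\<^sup>4\<close> gives one quarter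
  of this matrix.\<close>

definition weil_signs :: "int list list" where
  "weil_signs =
    [[1, 1, -1, 1, 1, -1, -1, -1, -1, 1, 1, 1, 1, 1, -1, 1],
     [1, -1, 1, 1, 1, 1, 1, -1, -1, -1, -1, 1, 1, -1, 1, 1],
     [1, 1, 1, -1, -1, 1, -1, -1, 1, -1, 1, 1, 1, 1, 1, -1],
     [-1, 1, 1, 1, 1, 1, -1, 1, -1, -1, 1, -1, -1, 1, 1, 1],
     [1, -1, 1, 1, -1, -1, -1, 1, 1, 1, 1, -1, 1, -1, 1, 1],
     [1, 1, -1, 1, -1, 1, 1, 1, 1, -1, -1, -1, 1, 1, -1, 1],
     [-1, 1, 1, 1, -1, -1, 1, -1, 1, 1, -1, 1, -1, 1, 1, 1],
     [1, 1, 1, -1, 1, -1, 1, 1, -1, 1, -1, -1, 1, 1, 1, -1],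
     [-1, -1, -1, 1, 1, -1, 1, 1, 1, -1, 1, 1, 1, 1, 1, -1],
     [-1, 1, 1, 1, 1, 1, -1, 1, 1, 1, -1, 1, 1, -1, -1, -1],
     [-1, -1, 1, -1, -1, 1, 1, 1, -1, 1, 1, 1, 1, 1, -1, 1],
     [1, -1, 1, 1, 1, 1, 1, -1, 1, 1, 1, -1, -1, 1, -1, -1],
     [1, -1, -1, -1, 1, 1, -1, 1, 1, 1, -1, 1, -1, 1, 1, 1],
     [1, 1, 1, -1, 1, -1, 1, 1, 1, -1, 1, 1, -1, -1, -1, 1],
     [-1, 1, -1, -1, 1, 1, 1, -1, 1, 1, 1, -1, 1, -1, 1, 1],
     [1, 1, -1, 1, -1, 1, 1, 1, -1, 1, 1, 1, -1, -1, 1, -1]]"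

section \<open>Evaluated properties of the two sign matrices\<close>

lemma list_square_quaternion_signs: "list_square 4 quaternion_signs"
  by code_simp

lemma list_square_weil_signs: "list_square 16 weil_signs"
  by code_simp

lemma quaternion_signs_orthogonal:
  "list_mult 4 quaternion_signs (list_columns 4 quaternion_signs) = list_scalar 4 4"
  by code_simp

text \<open>For A equal to half of this matrix the identity reads A^2 = A^T, which together with
  orthogonality gives A^3 = 1.\<close>

lemma quaternion_signs_square:
  "list_mult 4 quaternion_signs quaternion_signs = map (map ((*) 2)) (list_columns 4 quaternion_signs)"
  by code_simp

lemma quaternion_signs_entries: "list_all (list_all (\<lambda>x. x = 1 \<or> x = - 1)) quaternion_signs"
  by code_simp

lemma weil_signs_orthogonal:
  "list_mult 16 weil_signs (list_columns 16 weil_signs) = list_scalar 16 16"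
  by code_simp

lemma weil_signs_entries: "list_all (list_all (\<lambda>x. x = 1 \<or> x = - 1)) weil_signs"
  by code_simp

text \<open>For A equal to a quarter of this matrix, division by 16 shows that A^2 has entries
  +-1/4: the exponent k = 2.\<close>

lemma weil_signs_square_entries:
  "list_all (list_all (\<lambda>x. x = 4 \<or> x = - 4)) (list_mult 16 weil_signs weil_signs)"
  by code_simp

text \<open>For the same A, division by 256 gives A^4 = A^T, hence A^5 = 1.\<close>

lemma weil_signs_fourth_power:
  "list_mult 16 (list_mult 16 weil_signs weil_signs) (list_mult 16 weil_signs weil_signs) =
    map (map ((*) 64)) (list_columns 16 weil_signs)"
  by code_simp

lemma order_3_scaled_Hadamard_representation:
  assumes G: "group G" and o: "Coset.order G = 3"
  shows "\<exists>R. scaled_Hadamard_representation G 4 R"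
proof -
  define A where "A = (1 / 2 :: real) \<cdot>\<^sub>m list_mat 4 quaternion_signs"
  have AC: "A \<in> carrier_mat 4 4" by (simp add: A_def)
  have A: "orthogonal_matrix 4 A" unfolding A_def
    by (rule scaled_list_mat_orthogonal[OF list_square_quaternion_signs quaternion_signs_orthogonal]) simp
  have "A * A = (1 / 4) \<cdot>\<^sub>m (list_mat 4 quaternion_signs * list_mat 4 quaternion_signs)"
    by (simp add: A_def mult_smult_assoc_mat[of _ 4 4 _ 4] mult_smult_distrib[of _ 4 4 _ 4] smult_smult_mat)
  also have "\<dots> = A\<^sup>T"
    by (simp add: list_mat_mult list_square_quaternion_signs quaternion_signs_square list_mat_map
        list_square_columns A_def transpose_smult list_mat_transpose smult_smult_mat)
  finally have "A * A = A\<^sup>T" .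
  then have A3: "A ^\<^sub>m 3 = 1\<^sub>m 4"
    using A AC by (simp add: numeral_eq_Suc orthogonal_matrix_def)
  show ?thesis
  proof (rule prime_order_scaled_Hadamard_representation_half[OF G o _ A A3])
    fix k i j :: nat assume k: "0 < k" "2 * k \<le> 3" and ij: "i < 4" "j < 4"
    have "A ^\<^sub>m 1 = A" using AC by simp
    moreover have "k = 1" using k by simp
    moreover have "A $$ (i, j) \<in> {1 / 2, - 1 / 2}"
      using list_mat_entry[OF list_square_quaternion_signs quaternion_signs_entries ij] ij
        carrier_matD[OF list_mat_carrier[of 4 quaternion_signs]]
      by (auto simp: A_def)
    ultimately show "(A ^\<^sub>m k) $$ (i, j) \<in> {1 / sqrt (real 4), - 1 / sqrt (real 4)}" by simp
  qed simp
qed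

lemma order_5_scaled_Hadamard_representation:
  assumes G: "group G" and o: "Coset.order G = 5"
  shows "\<exists>R. scaled_Hadamard_representation G 16 R"
proof -
  define W where "W = list_mult 16 weil_signs weil_signs"
  define A where "A = (1 / 4 :: real) \<cdot>\<^sub>m list_mat 16 weil_signs"
  have W: "list_square 16 W" unfolding W_def by (rule list_square_mult[OF list_square_weil_signs])
  have AC: "A \<in> carrier_mat 16 16" by (simp add: A_def)
  have A: "orthogonal_matrix 16 A" unfolding A_def
    by (rule scaled_list_mat_orthogonal[OF list_square_weil_signs weil_signs_orthogonal]) simp
  have AA: "A * A = (1 / 16) \<cdot>\<^sub>m list_mat 16 W"
    by (simp add: A_def W_def mult_smult_assoc_mat[of _ 16 16 _ 16] mult_smult_distrib[of _ 16 16 _ 16]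
        smult_smult_mat list_mat_mult list_square_weil_signs)
  have "(A * A) * (A * A) = (1 / 256) \<cdot>\<^sub>m (list_mat 16 W * list_mat 16 W)"
    by (simp add: AA mult_smult_assoc_mat[of _ 16 16 _ 16] mult_smult_distrib[of _ 16 16 _ 16] smult_smult_mat)
  also have "list_mat 16 W * list_mat 16 W = 64 \<cdot>\<^sub>m list_mat 16 (list_columns 16 weil_signs)"
    using weil_signs_fourth_power
    by (simp add: list_mat_mult W list_mat_map list_square_columns list_square_weil_signs flip: W_def)
  also have "(1 / 256) \<cdot>\<^sub>m (64 \<cdot>\<^sub>m list_mat 16 (list_columns 16 weil_signs)) = A\<^sup>T"
    by (simp add: A_def transpose_smult list_mat_transpose list_square_weil_signs smult_smult_mat)
  finally have A4: "(A * A) * (A * A) = A\<^sup>T" .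
  have "A ^\<^sub>m 2 = A * A" using AC by (simp add: numeral_eq_Suc)
  then have "A ^\<^sub>m 4 = A\<^sup>T" using A4 pow_mat_add[OF AC, of 2 2] by simp
  then have A5: "A ^\<^sub>m 5 = 1\<^sub>m 16"
    using A AC pow_mat_add[OF AC, of 4 1] by (simp add: orthogonal_matrix_def)
  show ?thesis
  proof (rule prime_order_scaled_Hadamard_representation_half[OF G o _ A A5])
    fix k i j :: nat assume k: "0 < k" "2 * k \<le> 5" and ij: "i < 16" "j < 16"
    have "A $$ (i, j) \<in> {1 / 4, - 1 / 4}"
      using list_mat_entry[OF list_square_weil_signs weil_signs_entries ij] ij
        carrier_matD[OF list_mat_carrier[of 16 weil_signs]]
      by (auto simp: A_def)
    moreover have "(A * A) $$ (i, j) \<in> {1 / 4, - 1 / 4}"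
      using list_mat_entry[OF W weil_signs_square_entries[folded W_def] ij] ij
        carrier_matD[OF list_mat_carrier[of 16 W]]
      by (auto simp: AA)
    moreover have "A ^\<^sub>m 1 = A" using AC by simp
    moreover have "k = 1 \<or> k = 2" using k by auto
    ultimately show "(A ^\<^sub>m k) $$ (i, j) \<in> {1 / sqrt (real 16), - 1 / sqrt (real 16)}"
      using \<open>A ^\<^sub>m 2 = A * A\<close> real_sqrt_abs[of 4] by auto
  qed simp
qed

section \<open>Conjugated permutation representations\<close>

lemma prod_in_pm_power:
  fixes c :: real
  assumes "finite A" "\<And>x. x \<in> A \<Longrightarrow> f x \<in> {c, - c}"
  shows "prod f A \<in> {c ^ card A, - (c ^ card A)}"
  using assms
proof (induction A rule: finite_induct)
  case (insert x A)
  then have "f x \<in> {c, - c}" "prod f A \<in> {c ^ card A, - (c ^ card A)}" by auto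
  then show ?case using insert.hyps by auto
qed simp

text \<open>The matrix of g is M^T P M, with P the permutation matrix of \<open>\<phi> g\<close>.
  The hypothesis \<open>rows\<close> is M M^T = 1 and gives multiplicativity; \<open>cols\<close> is
  M^T M = 1 and sends the identity to the identity. Orthogonality holds because transposing P
  inverts the permutation.\<close>

lemma permutation_scaled_Hadamard_representation:
  fixes M :: "'i \<Rightarrow> 'j \<Rightarrow> real"
  assumes G: "group G"
    and I: "finite I" and J: "finite J" "card J = d"
    and rows: "\<And>w w'. w \<in> I \<Longrightarrow> w' \<in> I \<Longrightarrow> (\<Sum>u\<in>J. M w u * M w' u) = (if w = w' then 1 else 0)"
    and cols: "\<And>u u'. u \<in> J \<Longrightarrow> u' \<in> J \<Longrightarrow> (\<Sum>w\<in>I. M w u * M w u') = (if u = u' then 1 else 0)"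
    and closed: "\<And>g w. g \<in> carrier G \<Longrightarrow> w \<in> I \<Longrightarrow> \<phi> g w \<in> I"
    and one: "\<And>w. w \<in> I \<Longrightarrow> \<phi> \<one>\<^bsub>G\<^esub> w = w"
    and mult: "\<And>g h w. g \<in> carrier G \<Longrightarrow> h \<in> carrier G \<Longrightarrow> w \<in> I \<Longrightarrow>
      \<phi> (g \<otimes>\<^bsub>G\<^esub> h) w = \<phi> g (\<phi> h w)"
    and entries: "\<And>g u v. g \<in> carrier G \<Longrightarrow> g \<noteq> \<one>\<^bsub>G\<^esub> \<Longrightarrow> u \<in> J \<Longrightarrow> v \<in> J \<Longrightarrow>
      (\<Sum>w\<in>I. M (\<phi> g w) u * M w v) \<in> {1 / sqrt (real d), - 1 / sqrt (real d)}"
  shows "\<exists>R. scaled_Hadamard_representation G d R"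
proof -
  interpret group G by fact
  \<comment> \<open>An enumeration of \<open>J\<close> turns it into matrix indices.\<close>
  obtain e where e: "bij_betw e {..<d} J"
    using ex_bij_betw_nat_finite[OF J(1)] J(2) by (auto simp: lessThan_atLeast0)
  have eJ: "e i \<in> J" if "i < d" for i using e that by (auto simp: bij_betw_def)
  have e_eq: "e i = e j \<longleftrightarrow> i = j" if "i < d" "j < d" for i j
    using e that by (auto simp: bij_betw_def inj_on_def)
  define R where "R g = mat d d (\<lambda>(i, j). \<Sum>w\<in>I. M (\<phi> g w) (e i) * M w (e j))" for g
  have R [simp]: "R g \<in> carrier_mat d d" for g by (simp add: R_def)
  have R_mult: "R (g \<otimes>\<^bsub>G\<^esub> h) = R g * R h" if g: "g \<in> carrier G" and h: "h \<in> carrier G" for g h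
  proof (rule eq_matI)
    fix i j assume "i < dim_row (R g * R h)" "j < dim_col (R g * R h)"
    then have ij: "i < d" "j < d" by (simp_all add: R_def)
    have "(R g * R h) $$ (i, j) = (\<Sum>k<d. (\<Sum>w\<in>I. M (\<phi> g w) (e i) * M w (e k)) *
        (\<Sum>w'\<in>I. M (\<phi> h w') (e k) * M w' (e j)))"
      using ij by (simp add: R_def scalar_prod_def lessThan_atLeast0)
    also have "\<dots> = (\<Sum>u\<in>J. (\<Sum>w\<in>I. M (\<phi> g w) (e i) * M w u) * (\<Sum>w'\<in>I. M (\<phi> h w') u * M w' (e j)))"
      by (rule sum.reindex_bij_betw[OF e])
    also have "\<dots> = (\<Sum>u\<in>J. \<Sum>w'\<in>I. \<Sum>w\<in>I. M (\<phi> g w) (e i) * M w' (e j) * (M w u * M (\<phi> h w') u))"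
      by (intro sum.cong refl, unfold sum_product, subst sum.swap) (simp add: mult_ac)
    also have "\<dots> = (\<Sum>w'\<in>I. \<Sum>u\<in>J. \<Sum>w\<in>I. M (\<phi> g w) (e i) * M w' (e j) * (M w u * M (\<phi> h w') u))"
      by (rule sum.swap)
    also have "\<dots> = (\<Sum>w'\<in>I. \<Sum>w\<in>I. M (\<phi> g w) (e i) * M w' (e j) * (\<Sum>u\<in>J. M w u * M (\<phi> h w') u))"
      by (intro sum.cong refl, subst sum.swap) (simp add: sum_distrib_left)
    \<comment> \<open>Here M M^T = 1 enters: of the sum over w only one term survives.\<close>
    also have "\<dots> = (\<Sum>w'\<in>I. \<Sum>w\<in>I. if w = \<phi> h w' then M (\<phi> g w) (e i) * M w' (e j) else 0)"
      using closed[OF h] by (intro sum.cong refl) (simp add: rows)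
    also have "\<dots> = (\<Sum>w'\<in>I. M (\<phi> g (\<phi> h w')) (e i) * M w' (e j))"
      using closed[OF h] I by (intro sum.cong refl) simp
    also have "\<dots> = (\<Sum>w'\<in>I. M (\<phi> (g \<otimes>\<^bsub>G\<^esub> h) w') (e i) * M w' (e j))"
      by (intro sum.cong refl) (simp add: mult g h)
    also have "\<dots> = R (g \<otimes>\<^bsub>G\<^esub> h) $$ (i, j)" using ij by (simp add: R_def)
    finally show "R (g \<otimes>\<^bsub>G\<^esub> h) $$ (i, j) = (R g * R h) $$ (i, j)" by simp
  qed (simp_all add: R_def)
  have R_one: "R \<one>\<^bsub>G\<^esub> = 1\<^sub>m d"
  proof (rule eq_matI)
    fix i j assume "i < dim_row (1\<^sub>m d :: real mat)" "j < dim_col (1\<^sub>m d :: real mat)"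
    then have ij: "i < d" "j < d" by auto
    then have "R \<one>\<^bsub>G\<^esub> $$ (i, j) = (\<Sum>w\<in>I. M w (e i) * M w (e j))"
      by (simp add: R_def one cong: sum.cong)
    then show "R \<one>\<^bsub>G\<^esub> $$ (i, j) = 1\<^sub>m d $$ (i, j)" using ij by (simp add: cols eJ e_eq)
  qed (simp_all add: R_def)
  have R_inv: "(R g)\<^sup>T = R (inv\<^bsub>G\<^esub> g)" if g: "g \<in> carrier G" for g
  proof (rule eq_matI)
    fix i j assume "i < dim_row (R (inv\<^bsub>G\<^esub> g))" "j < dim_col (R (inv\<^bsub>G\<^esub> g))"
    then have ij: "i < d" "j < d" by (simp_all add: R_def)
    \<comment> \<open>Since \<open>\<phi>\<close> is an action, this is a bijection of
      \<open>I\<close>; substituting it moves the permutation from one factor to the other.\<close>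
    have bij: "bij_betw (\<phi> (inv\<^bsub>G\<^esub> g)) I I"
      using g mult[of g "inv\<^bsub>G\<^esub> g"] mult[of "inv\<^bsub>G\<^esub> g" g] one closed
      by (intro bij_betw_byWitness[where f' = "\<phi> g"]) auto
    have "(R g)\<^sup>T $$ (i, j) = (\<Sum>w\<in>I. M (\<phi> g w) (e j) * M w (e i))" using ij by (simp add: R_def)
    also have "\<dots> = (\<Sum>w\<in>I. M (\<phi> g (\<phi> (inv\<^bsub>G\<^esub> g) w)) (e j) * M (\<phi> (inv\<^bsub>G\<^esub> g) w) (e i))"
      by (rule sum.reindex_bij_betw[OF bij, symmetric])
    also have "\<dots> = (\<Sum>w\<in>I. M (\<phi> (inv\<^bsub>G\<^esub> g) w) (e i) * M w (e j))"
      using g one by (intro sum.cong refl) (simp add: mult[symmetric])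
    also have "\<dots> = R (inv\<^bsub>G\<^esub> g) $$ (i, j)" using ij by (simp add: R_def)
    finally show "(R g)\<^sup>T $$ (i, j) = R (inv\<^bsub>G\<^esub> g) $$ (i, j)" .
  qed (simp_all add: R_def)
  have "orthogonal_matrix d (R g)" if g: "g \<in> carrier G" for g
    using R_mult[of g "inv\<^bsub>G\<^esub> g"] R_mult[of "inv\<^bsub>G\<^esub> g" g] g
    by (simp add: orthogonal_matrix_def R_inv R_one)
  then have "R \<in> hom G (orthogonal_group d)"
    by (intro homI) (simp_all add: R_mult orthogonal_group_def general_linear_group_def units_of_def ring_mat_simps)
  then show ?thesis
    using entries eJ unfolding scaled_Hadamard_representation_def
    by (intro exI[of _ R] conjI ballI impI allI) (simp_all add: R_def)
qed

text \<open>The vectors of the basis \<open>E x\<close> are its columns, indexed by the last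
  argument. A sum over all functions of a product over G is a product of sums over \<open>Y\<close>,
  so every condition on the tensor product is checked one factor at a time.\<close>

lemma MUBs_scaled_Hadamard_representation:
  fixes E :: "'a \<Rightarrow> 'y \<Rightarrow> 'y \<Rightarrow> real"
  assumes G: "group G" and fin: "finite (carrier G)" and Y: "finite Y"
    and rows: "\<And>x y y'. x \<in> carrier G \<Longrightarrow> y \<in> Y \<Longrightarrow> y' \<in> Y \<Longrightarrow>
      (\<Sum>u\<in>Y. E x y u * E x y' u) = (if y = y' then 1 else 0)"
    and cols: "\<And>x u u'. x \<in> carrier G \<Longrightarrow> u \<in> Y \<Longrightarrow> u' \<in> Y \<Longrightarrow>
      (\<Sum>y\<in>Y. E x y u * E x y u') = (if u = u' then 1 else 0)"
    and unbiased: "\<And>x x' u v. x \<in> carrier G \<Longrightarrow> x' \<in> carrier G \<Longrightarrow> x \<noteq> x' \<Longrightarrow> u \<in> Y \<Longrightarrow> v \<in> Y \<Longrightarrow>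
      (\<Sum>y\<in>Y. E x y u * E x' y v) \<in> {1 / sqrt (real (card Y)), - (1 / sqrt (real (card Y)))}"
  shows "\<exists>R. scaled_Hadamard_representation G (card Y ^ card (carrier G)) R"
proof -
  interpret group G by fact
  define I where "I = PiE (carrier G) (\<lambda>_. Y)"
  define M where "M w u = (\<Prod>x\<in>carrier G. E x (w x) (u x))" for w u :: "'a \<Rightarrow> 'y"
  \<comment> \<open>The inverse makes this a left action on functions.\<close>
  define \<phi> where "\<phi> g w = (\<lambda>x\<in>carrier G. w (inv\<^bsub>G\<^esub> g \<otimes>\<^bsub>G\<^esub> x))" for g and w :: "'a \<Rightarrow> 'y"
  have I_eq: "(\<forall>x\<in>carrier G. u x = v x) \<longleftrightarrow> u = v" if "u \<in> I" "v \<in> I" for u v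
    using that by (auto simp: I_def intro: PiE_ext)
  have I_D: "u x \<in> Y" if "u \<in> I" "x \<in> carrier G" for u x using that by (auto simp: I_def)
  \<comment> \<open>A product of Kronecker deltas detects equality of functions, since members of
    \<open>I\<close> agree outside the carrier.\<close>
  have delta: "(\<Prod>x\<in>carrier G. if u x = v x then 1 else 0 :: real) = (if u = v then 1 else 0)"
    if "u \<in> I" "v \<in> I" for u v
    using I_eq[OF that] fin by (cases "u = v") (auto simp: prod_zero_iff)
  have \<phi>_bij: "bij_betw (\<lambda>x. g \<otimes>\<^bsub>G\<^esub> x) (carrier G) (carrier G)" if "g \<in> carrier G" for g
    using that by (intro bij_betw_byWitness[where f' = "\<lambda>x. inv\<^bsub>G\<^esub> g \<otimes>\<^bsub>G\<^esub> x"])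
      (auto simp flip: m_assoc)
  show ?thesis
  proof (rule permutation_scaled_Hadamard_representation[OF G, where I = I and J = I and M = M and \<phi> = \<phi>])
    show "finite I" "finite I" unfolding I_def using fin Y by (auto intro: finite_PiE)
    show d: "card I = card Y ^ card (carrier G)" unfolding I_def by (simp add: card_PiE fin)
    show "(\<Sum>u\<in>I. M w u * M w' u) = (if w = w' then 1 else 0)" if w: "w \<in> I" "w' \<in> I" for w w'
    proof -
      have "(\<Sum>u\<in>I. M w u * M w' u) = (\<Prod>x\<in>carrier G. \<Sum>y\<in>Y. E x (w x) y * E x (w' x) y)"
        using fin Y by (simp add: prod_sum_PiE I_def M_def prod.distrib)
      also have "\<dots> = (\<Prod>x\<in>carrier G. if w x = w' x then 1 else 0)"
        using w by (intro prod.cong refl) (simp add: rows I_D)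
      finally show ?thesis using delta[OF w] by simp
    qed
    show "(\<Sum>w\<in>I. M w u * M w u') = (if u = u' then 1 else 0)" if u: "u \<in> I" "u' \<in> I" for u u'
    proof -
      have "(\<Sum>w\<in>I. M w u * M w u') = (\<Prod>x\<in>carrier G. \<Sum>y\<in>Y. E x y (u x) * E x y (u' x))"
        using fin Y by (simp add: prod_sum_PiE I_def M_def prod.distrib)
      also have "\<dots> = (\<Prod>x\<in>carrier G. if u x = u' x then 1 else 0)"
        using u by (intro prod.cong refl) (simp add: cols I_D)
      finally show ?thesis using delta[OF u] by simp
    qed
    show "\<phi> g w \<in> I" if "g \<in> carrier G" "w \<in> I" for g w
      using that by (auto simp: \<phi>_def I_def)
    show "\<phi> \<one>\<^bsub>G\<^esub> w = w" if "w \<in> I" for w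
      using that by (auto simp: \<phi>_def I_def PiE_def intro!: extensionalityI[of _ "carrier G"])
    show "\<phi> (g \<otimes>\<^bsub>G\<^esub> h) w = \<phi> g (\<phi> h w)" if "g \<in> carrier G" "h \<in> carrier G" "w \<in> I" for g h w
      using that by (auto simp: \<phi>_def fun_eq_iff restrict_def inv_mult_group m_assoc)
    fix g u v assume g: "g \<in> carrier G" "g \<noteq> \<one>\<^bsub>G\<^esub>" and uv: "u \<in> I" "v \<in> I"
    have "(\<Sum>w\<in>I. M (\<phi> g w) u * M w v) =
        (\<Sum>w\<in>I. \<Prod>x\<in>carrier G. E (g \<otimes>\<^bsub>G\<^esub> x) (w x) (u (g \<otimes>\<^bsub>G\<^esub> x)) * E x (w x) (v x))"
    proof (intro sum.cong refl)
      fix w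
      \<comment> \<open>Substituting g x for x makes both products evaluate w at the same x, so that
        the sum over w factors.\<close>
      have "M (\<phi> g w) u = (\<Prod>x\<in>carrier G. E (g \<otimes>\<^bsub>G\<^esub> x) (\<phi> g w (g \<otimes>\<^bsub>G\<^esub> x)) (u (g \<otimes>\<^bsub>G\<^esub> x)))"
        unfolding M_def by (rule prod.reindex_bij_betw[OF \<phi>_bij[OF g(1)], symmetric])
      also have "\<dots> = (\<Prod>x\<in>carrier G. E (g \<otimes>\<^bsub>G\<^esub> x) (w x) (u (g \<otimes>\<^bsub>G\<^esub> x)))"
        using g(1) by (intro prod.cong refl) (simp add: \<phi>_def flip: m_assoc)
      finally show "M (\<phi> g w) u * M w v =
          (\<Prod>x\<in>carrier G. E (g \<otimes>\<^bsub>G\<^esub> x) (w x) (u (g \<otimes>\<^bsub>G\<^esub> x)) * E x (w x) (v x))"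
        by (simp add: prod.distrib M_def)
    qed
    also have "\<dots> = (\<Prod>x\<in>carrier G. \<Sum>y\<in>Y. E (g \<otimes>\<^bsub>G\<^esub> x) y (u (g \<otimes>\<^bsub>G\<^esub> x)) * E x y (v x))"
      using fin Y by (simp add: prod_sum_PiE I_def)
    \<comment> \<open>Translation by g other than the identity has no fixed point, so every factor
      compares two different bases.\<close>
    also have "\<dots> \<in> {(1 / sqrt (real (card Y))) ^ card (carrier G),
        - ((1 / sqrt (real (card Y))) ^ card (carrier G))}"
      using g uv by (intro prod_in_pm_power fin unbiased) (auto simp: I_D r_cancel_one)
    finally show "(\<Sum>w\<in>I. M (\<phi> g w) u * M w v) \<in> {1 / sqrt (real (card Y ^ card (carrier G))),
        - 1 / sqrt (real (card Y ^ card (carrier G)))}"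
      by (simp add: power_divide real_sqrt_power)
  qed
qed

section \<open>Mutually unbiased bases from cyclic shifts of even subsets\<close>

definition even_subsets :: "nat \<Rightarrow> nat set set" where
  "even_subsets p = {S. S \<subseteq> {..<p} \<and> even (card S)}"

text \<open>The sign of the standard bilinear form over GF(2); for a fixed argument it is a
  character of finite sets under symmetric difference.\<close>

definition chi :: "nat set \<Rightarrow> nat set \<Rightarrow> real" where
  "chi S T = (- 1) ^ card (S \<inter> T)"

definition cyclic_shift :: "nat \<Rightarrow> nat \<Rightarrow> nat set \<Rightarrow> nat set" where
  "cyclic_shift p t S = (\<lambda>i. (i + t) mod p) ` S"

lemma finite_even_subsets [simp]: "finite (even_subsets p)"
  unfolding even_subsets_def by (rule finite_subset[of _ "Pow {..<p}"]) auto

lemma even_subsets_finite: "S \<in> even_subsets p \<Longrightarrow> finite S"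
  unfolding even_subsets_def using finite_subset by auto

text \<open>Forgetting \<open>m\<close> loses nothing, as parity tells whether it was present. The
  2-power sizes come from here.\<close>

lemma card_even_subsets: "card (even_subsets (Suc m)) = 2 ^ m"
proof -
  have "bij_betw (\<lambda>S. S \<inter> {..<m}) (even_subsets (Suc m)) (Pow {..<m})"
  proof (rule bij_betw_byWitness[where f' = "\<lambda>S. if even (card S) then S else insert m S"])
    show "\<forall>S\<in>even_subsets (Suc m). (if even (card (S \<inter> {..<m})) then S \<inter> {..<m} else insert m (S \<inter> {..<m})) = S"
    proof
      fix S assume S: "S \<in> even_subsets (Suc m)"
      then have fin: "finite (S \<inter> {..<m})" and sub: "S \<subseteq> {..<Suc m}" and ev: "even (card S)"
        by (auto simp: even_subsets_def)
      show "(if even (card (S \<inter> {..<m})) then S \<inter> {..<m} else insert m (S \<inter> {..<m})) = S"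
      proof (cases "m \<in> S")
        case True
        then have "insert m (S \<inter> {..<m}) = S" using sub by (auto simp: less_Suc_eq)
        moreover have "card (insert m (S \<inter> {..<m})) = Suc (card (S \<inter> {..<m}))" using fin by simp
        ultimately show ?thesis using ev by auto
      next
        case False
        then have "S \<inter> {..<m} = S" using sub by (auto simp: less_Suc_eq)
        then show ?thesis using ev by simp
      qed
    qed
    show "\<forall>S\<in>Pow {..<m}. (if even (card S) then S else insert m S) \<inter> {..<m} = S" by auto
    show "(\<lambda>S. S \<inter> {..<m}) ` even_subsets (Suc m) \<subseteq> Pow {..<m}" by auto
    show "(\<lambda>S. if even (card S) then S else insert m S) ` Pow {..<m} \<subseteq> even_subsets (Suc m)"
    proof clarify
      fix S assume S: "S \<subseteq> {..<m}"
      then have "finite S" "m \<notin> S" using finite_subset by auto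
      then have "card (insert m S) = Suc (card S)" by simp
      then show "(if even (card S) then S else insert m S) \<in> even_subsets (Suc m)"
        using S by (force simp: even_subsets_def)
    qed
  qed
  then show ?thesis by (simp add: bij_betw_same_card card_Pow)
qed

lemma chi_commute: "chi S T = chi T S"
  by (simp add: chi_def Int_commute)

lemma chi_square [simp]: "chi S T * chi S T = 1"
  by (simp add: chi_def flip: power_mult_distrib)

lemma chi_in: "chi S T \<in> {1, - 1}"
  by (cases "even (card (S \<inter> T))") (simp_all add: chi_def)

text \<open>The size of the symmetric difference is |S| + |T| minus twice the size of the
  intersection.\<close>

lemma minus_one_power_card_sym_diff:
  assumes "finite S" "finite T"
  shows "(- 1 :: real) ^ card (sym_diff S T) = (- 1) ^ card S * (- 1) ^ card T"
proof -
  have "card (sym_diff S T) = card (S - T) + card (T - S)"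
    using assms by (intro card_Un_disjoint) auto
  then have "card (sym_diff S T) + 2 * card (S \<inter> T) = card S + card T"
    using card_Int_Diff[OF assms(1), of T] card_Int_Diff[OF assms(2), of S] by (simp add: Int_commute)
  moreover have "even a \<longleftrightarrow> (even b \<longleftrightarrow> even c)" if "a + 2 * k = b + c" for a b c k :: nat
    using that by presburger
  ultimately have "even (card (sym_diff S T)) \<longleftrightarrow> (even (card S) \<longleftrightarrow> even (card T))" by blast
  then show ?thesis by (cases "even (card S)"; cases "even (card T)") simp_all
qed

lemma even_subsets_sym_diff:
  assumes "S \<in> even_subsets p" "T \<in> even_subsets p"
  shows "sym_diff S T \<in> even_subsets p"
proof -
  have "(- 1 :: real) ^ card (sym_diff S T) = 1"
    using assms minus_one_power_card_sym_diff[OF assms[THEN even_subsets_finite]]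
    by (simp add: even_subsets_def)
  then have "even (card (sym_diff S T))" by (cases "even (card (sym_diff S T))") simp_all
  then show ?thesis using assms by (auto simp: even_subsets_def)
qed

lemma chi_sym_diff:
  assumes "finite S" "finite S'"
  shows "chi (sym_diff S S') T = chi S T * chi S' T"
proof -
  have "sym_diff S S' \<inter> T = sym_diff (S \<inter> T) (S' \<inter> T)" by auto
  then show ?thesis
    using minus_one_power_card_sym_diff[of "S \<inter> T" "S' \<inter> T"] assms by (simp add: chi_def)
qed

lemma chi_sym_diff_right:
  assumes "finite T" "finite T'"
  shows "chi S (sym_diff T T') = chi S T * chi S T'"
  using chi_sym_diff[OF assms] by (simp add: chi_commute)

text \<open>A nonempty even S misses some j because \<open>p\<close> is odd. With i in S, the pair
  {i, j} is even and has sign -1 against S, so adding it to T reverses every term. Thus the form is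
  nondegenerate on even subsets.\<close>

lemma sum_chi:
  assumes p: "odd p" and S: "S \<in> even_subsets p"
  shows "(\<Sum>T\<in>even_subsets p. chi S T) = (if S = {} then real (card (even_subsets p)) else 0)"
proof (cases "S = {}")
  case True
  then show ?thesis by (simp add: chi_def)
next
  case False
  then obtain i where i: "i \<in> S" by blast
  have sub: "S \<subseteq> {..<p}" and "even (card S)" using S by (auto simp: even_subsets_def)
  then have "S \<noteq> {..<p}" using p by auto
  then obtain j where j: "j < p" "j \<notin> S" using sub by auto
  have "i \<noteq> j" "i < p" using i j sub by auto
  define D where "D = {i, j}"
  have D: "D \<in> even_subsets p" using i j sub \<open>i \<noteq> j\<close> by (auto simp: D_def even_subsets_def)
  have "S \<inter> D = {i}" using i j by (auto simp: D_def)
  then have chiD: "chi S D = - 1" by (simp add: chi_def)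
  have "bij_betw (\<lambda>T. sym_diff T D) (even_subsets p) (even_subsets p)"
    using even_subsets_sym_diff[OF _ D]
    by (intro bij_betw_byWitness[where f' = "\<lambda>T. sym_diff T D"]) auto
  then have "(\<Sum>T\<in>even_subsets p. chi S T) = (\<Sum>T\<in>even_subsets p. chi S (sym_diff T D))"
    by (rule sum.reindex_bij_betw[symmetric])
  also have "\<dots> = (\<Sum>T\<in>even_subsets p. - chi S T)"
    using D even_subsets_finite by (intro sum.cong refl) (simp add: chi_sym_diff_right chiD)
  finally have "(\<Sum>T\<in>even_subsets p. chi S T) = - (\<Sum>T\<in>even_subsets p. chi S T)"
    by (simp add: sum_negf)
  then have "(\<Sum>T\<in>even_subsets p. chi S T) = 0" by linarith
  then show ?thesis using False by simp
qed

section \<open>Cyclic shifts and their differences\<close>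

lemma inj_on_add_mod: "inj_on (\<lambda>i. (i + t) mod p) {..<p :: nat}"
proof (rule inj_onI)
  fix i j assume "i \<in> {..<p}" "j \<in> {..<p}" "(i + t) mod p = (j + t) mod p"
  then show "i = j" 
    using cong_add_rcancel_nat[of i t j p] by (simp add: cong_def)
qed

lemma cyclic_shift_sym_diff:
  assumes "S \<subseteq> {..<p}" "T \<subseteq> {..<p}"
  shows "cyclic_shift p t (sym_diff S T) = sym_diff (cyclic_shift p t S) (cyclic_shift p t T)"
  unfolding cyclic_shift_def image_Un
  by (rule arg_cong2[of _ _ _ _ "(\<union>)"]; rule inj_on_image_set_diff[OF inj_on_add_mod]) (use assms in auto)

lemma cyclic_shift_even_subsets:
  assumes "S \<in> even_subsets p"
  shows "cyclic_shift p t S \<in> even_subsets p"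
proof -
  have "S \<subseteq> {..<p}" using assms by (simp add: even_subsets_def)
  then have "card (cyclic_shift p t S) = card S"
    unfolding cyclic_shift_def by (intro card_image inj_on_subset[OF inj_on_add_mod])
  moreover have "p > 0 \<or> S = {}" using \<open>S \<subseteq> {..<p}\<close> by auto
  ultimately show ?thesis using assms by (auto simp: even_subsets_def cyclic_shift_def)
qed

text \<open>Such an S is invariant under the shift by t - s, whose multiples run through all
  residues modulo the prime \<open>p\<close>. If nonempty, S would be everything and of odd
  size.\<close>

lemma cyclic_shift_eq_imp_empty:
  assumes p: "Factorial_Ring.prime p" "odd p" and S: "S \<in> even_subsets p"
    and ts: "s < t" "t < p" and eq: "cyclic_shift p s S = cyclic_shift p t S"
  shows "S = {}"
proof (rule ccontr)
  assume "S \<noteq> {}"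
  have sub: "S \<subseteq> {..<p}" and ev: "even (card S)" using S by (auto simp: even_subsets_def)
  define k where "k = t - s"
  have k: "0 < k" "k < p" using ts by (auto simp: k_def)
  \<comment> \<open>The element i shifted by t is some j in S shifted by s; cancelling s leaves i +
    k = j modulo \<open>p\<close>.\<close>
  have step: "(i + k) mod p \<in> S" if "i \<in> S" for i
  proof -
    have "(i + t) mod p \<in> cyclic_shift p s S" unfolding eq using that by (simp add: cyclic_shift_def)
    then obtain j where j: "j \<in> S" "(i + t) mod p = (j + s) mod p" by (auto simp: cyclic_shift_def)
    have "((i + k) mod p + s) mod p = (i + t) mod p"
      using ts by (simp add: k_def mod_add_left_eq)
    then have "(i + k) mod p = j"
      using inj_onD[OF inj_on_add_mod[of s p], of "(i + k) mod p" j] j sub k by auto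
    then show ?thesis using j by simp
  qed
  obtain i where i: "i \<in> S" using \<open>S \<noteq> {}\<close> by blast
  have iter: "(i + n * k) mod p \<in> S" for n
  proof (induction n)
    case 0
    then show ?case using i sub by auto
  next
    case (Suc n)
    have "((i + n * k) mod p + k) mod p = (i + Suc n * k) mod p"
      by (simp only: mod_add_left_eq) (simp add: algebra_simps)
    then show ?case using step[OF Suc] by simp
  qed
  have "inj_on (\<lambda>n. (i + n * k) mod p) {..<p}"
  proof (rule inj_onI)
    fix a b assume ab: "a \<in> {..<p}" "b \<in> {..<p}" "(i + a * k) mod p = (i + b * k) mod p"
    then have "[i + a * k = i + b * k] (mod p)" by (simp add: cong_def)
    then have "[a * k = b * k] (mod p)" by (simp add: cong_add_lcancel_nat)
    moreover have "coprime k p"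
      using p(1) k by (metis coprime_commute nat_dvd_not_less prime_imp_coprime)
    ultimately have "[a = b] (mod p)" using cong_mult_rcancel_nat by blast
    then show "a = b" using ab by (simp add: cong_def)
  qed
  then have "card ((\<lambda>n. (i + n * k) mod p) ` {..<p}) = p" by (simp add: card_image)
  moreover have "(\<lambda>n. (i + n * k) mod p) ` {..<p} \<subseteq> S" using iter by auto
  ultimately have "p \<le> card S"
    using card_mono[OF even_subsets_finite[OF S]] by metis
  then have "S = {..<p}"
    using sub card_mono[OF finite_lessThan sub] by (intro card_subset_eq) simp_all
  then show False using ev p(2) by simp
qed

section \<open>The bases of R^(V x V)\<close>

lemma sum_Times_product:
  fixes f g :: "'a \<Rightarrow> real"
  shows "(\<Sum>x\<in>A \<times> B. f (fst x) * g (snd x)) = (\<Sum>a\<in>A. f a) * (\<Sum>b\<in>B. g b)"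
  by (simp add: sum_product sum.cartesian_product case_prod_beta)

text \<open>The product of two characters is the character of the symmetric difference, which
  reduces orthogonality to a single character sum.\<close>

lemma sum_chi_mult:
  assumes p: "odd p" and S: "S \<in> even_subsets p" and S': "S' \<in> even_subsets p"
  shows "(\<Sum>T\<in>even_subsets p. chi S T * chi S' T) = (if S = S' then real (card (even_subsets p)) else 0)"
proof -
  have "(\<Sum>T\<in>even_subsets p. chi S T * chi S' T) = (\<Sum>T\<in>even_subsets p. chi (sym_diff S S') T)"
    using S S' by (simp add: chi_sym_diff even_subsets_finite)
  also have "\<dots> = (if sym_diff S S' = {} then real (card (even_subsets p)) else 0)"
    by (rule sum_chi[OF p even_subsets_sym_diff[OF S S']])
  also have "sym_diff S S' = {} \<longleftrightarrow> S = S'" by auto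
  finally show ?thesis .
qed

text \<open>Here \<open>y\<close> is the coordinate and \<open>u\<close> the index of the basis
  vector. The first factor is the sign of the form for shift \<open>t\<close>, the next two are a
  character of V x V, and the denominator is the square root of the size of V x V.\<close>

definition shift_basis ::
    "nat \<Rightarrow> nat \<Rightarrow> nat set \<times> nat set \<Rightarrow> nat set \<times> nat set \<Rightarrow> real" where
  "shift_basis p t y u =
     chi (cyclic_shift p t (fst y)) (snd y) * chi (fst u) (fst y) * chi (snd u) (snd y)
       / real (card (even_subsets p))"

text \<open>The form signs at y and y' do not involve u and leave the sum; character orthogonality
  in each component remains.\<close>

lemma shift_basis_rows:
  assumes p: "odd p" and y: "y \<in> even_subsets p \<times> even_subsets p" "y' \<in> even_subsets p \<times> even_subsets p"
  shows "(\<Sum>u\<in>even_subsets p \<times> even_subsets p. shift_basis p t y u * shift_basis p t y' u)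
    = (if y = y' then 1 else 0)"
proof -
  let ?V = "even_subsets p" and ?q = "real (card (even_subsets p))"
  let ?c = "\<lambda>y. chi (cyclic_shift p t (fst y)) (snd y)"
  have q: "?q \<noteq> 0" using y by (auto simp: card_eq_0_iff)
  have "(\<Sum>u\<in>?V \<times> ?V. shift_basis p t y u * shift_basis p t y' u) =
      (\<Sum>u\<in>?V \<times> ?V. ?c y * ?c y' / ?q\<^sup>2 *
        ((chi (fst y) (fst u) * chi (fst y') (fst u)) * (chi (snd y) (snd u) * chi (snd y') (snd u))))"
    by (simp add: shift_basis_def chi_commute[of "fst y"] chi_commute[of "snd y"]
        chi_commute[of "fst y'"] chi_commute[of "snd y'"] power2_eq_square mult_ac)
  also have "\<dots> = ?c y * ?c y' / ?q\<^sup>2 *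
      ((\<Sum>T\<in>?V. chi (fst y) T * chi (fst y') T) * (\<Sum>T\<in>?V. chi (snd y) T * chi (snd y') T))"
    by (simp only: sum_distrib_left[symmetric] sum_Times_product[of
        "\<lambda>T. chi (fst y) T * chi (fst y') T" "\<lambda>T. chi (snd y) T * chi (snd y') T"])
  also have "\<dots> = (if y = y' then 1 else 0)"
    using p y q by (cases "fst y = fst y'"; cases "snd y = snd y'")
      (simp_all add: sum_chi_mult power2_eq_square prod_eq_iff mem_Times_iff)
  finally show ?thesis .
qed

text \<open>The form sign occurs twice at the same y and cancels before summation.\<close>

lemma shift_basis_cols:
  assumes p: "odd p" and u: "u \<in> even_subsets p \<times> even_subsets p" "u' \<in> even_subsets p \<times> even_subsets p"
  shows "(\<Sum>y\<in>even_subsets p \<times> even_subsets p. shift_basis p t y u * shift_basis p t y u')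
    = (if u = u' then 1 else 0)"
proof -
  let ?V = "even_subsets p" and ?q = "real (card (even_subsets p))"
  let ?c = "\<lambda>y. chi (cyclic_shift p t (fst y)) (snd y)"
  have q: "?q \<noteq> 0" using u by (auto simp: card_eq_0_iff)
  have "(\<Sum>y\<in>?V \<times> ?V. shift_basis p t y u * shift_basis p t y u') =
      (\<Sum>y\<in>?V \<times> ?V. (?c y * ?c y) / ?q\<^sup>2 *
        ((chi (fst u) (fst y) * chi (fst u') (fst y)) * (chi (snd u) (snd y) * chi (snd u') (snd y))))"
    by (simp add: shift_basis_def power2_eq_square mult_ac del: chi_square)
  also have "\<dots> = 1 / ?q\<^sup>2 *
      ((\<Sum>T\<in>?V. chi (fst u) T * chi (fst u') T) * (\<Sum>T\<in>?V. chi (snd u) T * chi (snd u') T))"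
    by (simp only: chi_square sum_distrib_left[symmetric] sum_Times_product[of
        "\<lambda>T. chi (fst u) T * chi (fst u') T" "\<lambda>T. chi (snd u) T * chi (snd u') T"])
  also have "\<dots> = (if u = u' then 1 else 0)"
    using p u q by (cases "fst u = fst u'"; cases "snd u = snd u'")
      (simp_all add: sum_chi_mult power2_eq_square prod_eq_iff mem_Times_iff)
  finally show ?thesis .
qed

text \<open>For a fixed first coordinate a, the sum over the second is an orthogonality relation
  that vanishes unless \<open>\<pi> a = \<gamma>\<close>. As \<open>\<pi>\<close> is bijective,
  exactly one a contributes; its inner sum |V| against the factor 1/|V|^2 leaves +-1/|V|.\<close>

lemma shift_basis_unbiased:
  assumes p: "Factorial_Ring.prime p" "odd p" and st: "s < p" "t < p" "s \<noteq> t"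
    and u: "u \<in> even_subsets p \<times> even_subsets p" "v \<in> even_subsets p \<times> even_subsets p"
  shows "\<bar>\<Sum>y\<in>even_subsets p \<times> even_subsets p. shift_basis p s y u * shift_basis p t y v\<bar>
    = 1 / real (card (even_subsets p))"
proof -
  let ?V = "even_subsets p" and ?q = "real (card (even_subsets p))"
  have q: "?q \<noteq> 0" using u by (auto simp: card_eq_0_iff)
  define \<pi> where "\<pi> a = sym_diff (cyclic_shift p s a) (cyclic_shift p t a)" for a
  have \<pi>: "\<pi> a \<in> ?V" if "a \<in> ?V" for a
    using that by (simp add: \<pi>_def even_subsets_sym_diff cyclic_shift_even_subsets)
  have fin: "finite (cyclic_shift p r a)" if "a \<in> ?V" for r a
    using even_subsets_finite[OF that] by (simp add: cyclic_shift_def)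
  have "inj_on \<pi> ?V"
  proof (rule inj_onI)
    fix a b assume ab: "a \<in> ?V" "b \<in> ?V" and eq: "\<pi> a = \<pi> b"
    have sub: "a \<subseteq> {..<p}" "b \<subseteq> {..<p}" using ab by (auto simp: even_subsets_def)
    \<comment> \<open>Shifts are additive, so injectivity of \<open>\<pi>\<close> reduces to a
      trivial kernel.\<close>
    have "cyclic_shift p s (sym_diff a b) = cyclic_shift p t (sym_diff a b)"
      using eq unfolding \<pi>_def cyclic_shift_sym_diff[OF sub] by blast
    then have "sym_diff a b = {}"
      using cyclic_shift_eq_imp_empty[OF p even_subsets_sym_diff[OF ab]] st by (metis linorder_neqE_nat)
    then show "a = b" by auto
  qed
  then have bij: "bij_betw \<pi> ?V ?V"
    using \<pi> by (intro bij_betw_imageI endo_inj_surj) auto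
  \<comment> \<open>The characters at u and v multiply to the one at their difference, with
    components \<open>\<delta>\<close> and \<open>\<gamma>\<close>.\<close>
  define \<gamma> where "\<gamma> = sym_diff (snd u) (snd v)"
  define \<delta> where "\<delta> = sym_diff (fst u) (fst v)"
  have \<gamma>: "\<gamma> \<in> ?V" using u by (auto simp: \<gamma>_def intro: even_subsets_sym_diff)
  obtain a0 where a0: "a0 \<in> ?V" "\<And>a. a \<in> ?V \<Longrightarrow> \<pi> a = \<gamma> \<longleftrightarrow> a = a0"
    using bij \<gamma> unfolding bij_betw_def inj_on_def by (metis imageE)
  have "(\<Sum>y\<in>?V \<times> ?V. shift_basis p s y u * shift_basis p t y v) =
      (\<Sum>(a, b)\<in>?V \<times> ?V. chi \<delta> a / ?q\<^sup>2 * (chi (\<pi> a) b * chi \<gamma> b))"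
    using u by (intro sum.cong refl)
      (auto simp: shift_basis_def \<pi>_def \<gamma>_def \<delta>_def chi_sym_diff even_subsets_finite
        fin power2_eq_square mult_ac)
  also have "\<dots> = (\<Sum>a\<in>?V. chi \<delta> a / ?q\<^sup>2 * (\<Sum>b\<in>?V. chi (\<pi> a) b * chi \<gamma> b))"
    by (simp only: sum.cartesian_product[symmetric] sum_distrib_left)
  also have "\<dots> = (\<Sum>a\<in>?V. if a = a0 then chi \<delta> a / ?q else 0)"
    using p(2) \<pi> \<gamma> a0(2) q by (intro sum.cong refl) (simp add: sum_chi_mult power2_eq_square)
  also have "\<dots> = chi \<delta> a0 / ?q" using a0(1) by simp
  finally have "(\<Sum>y\<in>?V \<times> ?V. shift_basis p s y u * shift_basis p t y v) = chi \<delta> a0 / ?q" .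
  moreover have "\<bar>chi \<delta> a0\<bar> = 1" using chi_in[of \<delta> a0] by auto
  ultimately show ?thesis by (simp only: abs_divide abs_of_nat)
qed

section \<open>Finite groups\<close>

text \<open>Numbering the group elements assigns to each its own shift, hence its own basis in the
  unbiased family.\<close>

lemma finite_group_scaled_Hadamard_representation:
  assumes G: "group G" and fin: "finite (carrier G)"
  shows "\<exists>k R. scaled_Hadamard_representation G (2 ^ k) R \<and> inj_on R (carrier G)"
proof -
  interpret group G by fact
  define n where "n = card (carrier G)"
  have n: "n > 0" unfolding n_def using fin one_closed by (auto simp: card_gt_0_iff)
  \<comment> \<open>Exceeding 2 makes the prime odd; exceeding n leaves enough shifts for all group
    elements.\<close>
  obtain p where p: "Factorial_Ring.prime p" "max 2 n < p" using bigger_prime by blast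
  then have op: "odd p" by (intro prime_odd_nat) auto
  obtain m where m: "p = Suc m" using p(2) by (cases p) auto
  obtain f where "bij_betw f (carrier G) {0..<n}"
    unfolding n_def using ex_bij_betw_finite_nat[OF fin] by blast
  then have f: "inj_on f (carrier G)" and "f ` carrier G = {0..<n}"
    by (simp_all add: bij_betw_def)
  then have fp: "f x < p" if "x \<in> carrier G" for x
  proof -
    have "f x \<in> {0..<n}" using that \<open>f ` carrier G = {0..<n}\<close> by blast
    then show ?thesis using p(2) by simp
  qed
  define Y where "Y = even_subsets p \<times> even_subsets p"
  have cardY: "card Y = card (even_subsets p) * card (even_subsets p)"
    by (simp add: Y_def card_cartesian_product)
  have "\<exists>R. scaled_Hadamard_representation G (card Y ^ card (carrier G)) R"
  proof (rule MUBs_scaled_Hadamard_representation[OF G fin, where E = "\<lambda>x. shift_basis p (f x)"])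
    show "finite Y" by (simp add: Y_def)
    show "(\<Sum>u\<in>Y. shift_basis p (f x) y u * shift_basis p (f x) y' u) = (if y = y' then 1 else 0)"
      if "y \<in> Y" "y' \<in> Y" for x y y'
      using that unfolding Y_def by (rule shift_basis_rows[OF op])
    show "(\<Sum>y\<in>Y. shift_basis p (f x) y u * shift_basis p (f x) y u') = (if u = u' then 1 else 0)"
      if "u \<in> Y" "u' \<in> Y" for x u u'
      using that unfolding Y_def by (rule shift_basis_cols[OF op])
    fix x x' u v
    assume x: "x \<in> carrier G" "x' \<in> carrier G" "x \<noteq> x'" and uv: "u \<in> Y" "v \<in> Y"
    have "f x \<noteq> f x'" using x f by (auto dest: inj_onD)
    then have "\<bar>\<Sum>y\<in>Y. shift_basis p (f x) y u * shift_basis p (f x') y v\<bar> =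
        1 / real (card (even_subsets p))"
      using x fp uv unfolding Y_def by (intro shift_basis_unbiased[OF p(1) op]) auto
    also have "real (card (even_subsets p)) = sqrt (real (card Y))"
      by (simp add: cardY)
    finally show "(\<Sum>y\<in>Y. shift_basis p (f x) y u * shift_basis p (f x') y v) \<in>
        {1 / sqrt (real (card Y)), - (1 / sqrt (real (card Y)))}"
      by (auto simp: abs_if split: if_splits)
  qed
  \<comment> \<open>V has 2^m elements for p = m + 1, so \<open>Y\<close> has 2^(2 m), and there is
    one tensor factor per group element.\<close>
  moreover have "card Y ^ card (carrier G) = 2 ^ (2 * m * n)"
    unfolding cardY m card_even_subsets n_def
    by (simp only: power_add[symmetric] power_mult[symmetric] mult_2)
  ultimately obtain R where R: "scaled_Hadamard_representation G (2 ^ (2 * m * n)) R" by auto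
  \<comment> \<open>Both m and n are positive, so the dimension is at least 2, as faithfulness
    requires.\<close>
  have "(2 :: nat) ^ 1 \<le> 2 ^ (2 * m * n)"
    using n p(2) m by (intro power_increasing) auto
  then have "inj_on R (carrier G)"
    by (intro scaled_Hadamard_representation_inj_on[OF G R]) simp
  with R show ?thesis by blast
qed

theorem mainTheorem3:
  shows "(\<forall>G :: ('a, 'b) monoid_scheme. group G \<and> Coset.order G = 5 \<longrightarrow>
            (\<exists>R. real_representation G 16 R \<and> defines_MUBs G 16 R)) \<and>
         (\<forall>G :: ('a, 'b) monoid_scheme. group G \<and> Coset.order G = 3 \<longrightarrow>
            (\<exists>R. real_representation G 4 R \<and> defines_MUBs G 4 R)) \<and>
         (\<forall>G :: ('a, 'b) monoid_scheme. group G \<and> finite (carrier G) \<and> odd (Coset.order G) \<longrightarrow>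
            (\<exists>k R. scaled_Hadamard_representation G (2 ^ k) R \<and> inj_on R (carrier G)))"
proof (intro conjI allI impI)
  fix G :: "('a, 'b) monoid_scheme"
  assume "group G \<and> Coset.order G = 5"
  then show "\<exists>R. real_representation G 16 R \<and> defines_MUBs G 16 R"
    using order_5_scaled_Hadamard_representation scaled_Hadamard_representation_real_representation
      scaled_Hadamard_representation_defines_MUBs by blast
next
  fix G :: "('a, 'b) monoid_scheme"
  assume "group G \<and> Coset.order G = 3"
  then show "\<exists>R. real_representation G 4 R \<and> defines_MUBs G 4 R"
    using order_3_scaled_Hadamard_representation scaled_Hadamard_representation_real_representation
      scaled_Hadamard_representation_defines_MUBs by blast
next
  fix G :: "('a, 'b) monoid_scheme"
  assume "group G \<and> finite (carrier G) \<and> odd (Coset.order G)"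
  then show "\<exists>k R. scaled_Hadamard_representation G (2 ^ k) R \<and> inj_on R (carrier G)"
    using finite_group_scaled_Hadamard_representation by blast
qed

end
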